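(* Let $U\subset\mathbb C$ be an open set, let $\theta>0$, and let $\mathbf x=(x_1>x_2>\dots>x_n)\in\mathbb W_\theta^n$ be a particle configuration such that $[x_n,x_1]\subset U$. Let $\phi^+,\phi^-$ be two holomorphic functions on $U$ and let $b$ be a conformal (i.e. holomorphic and injective) function on $U$. Assume that the random $n$-tuple $\mathbf e=(e_1,\dots,e_n)\in\{0,1\}^n$ is distributed according to the transition probability $$\mathbb P(\mathbf x+\mathbf e\mid \mathbf x)=\frac1{Z(\mathbf x)}\prod_{1\le i<j\le n}\frac{b(x_i+\theta e_i)-b(x_j+\theta e_j)}{b(x_i)-b(x_j)}\prod_{i=1}^n\phi^+(x_i)^{e_i}\phi^-(x_i)^{1-e_i}.$$ Then the following observable is a holomorphic function of $z\in U$: $$\mathbb E\left[\phi^+(z)\prod_{j=1}^n\frac{b(z+\theta)-b(x_j+\theta e_j)}{b(z)-b(x_j)}+\phi^-(z)\prod_{j=1}^n\frac{b(z)-b(x_j+\theta e_j)}{b(z)-b(x_j)}\right].$$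
   Context: For $\theta>0$, $\mathbb W_\theta^n=\{(x_1,\dots,x_n)\in\mathbb R^n : x_1\in\mathbb Z,\ x_i-x_{i+1}\in\theta+\mathbb Z_{\ge0},\ i=1,\dots,n-1\}$. In the transition probability, $\mathbf x,\mathbf x+\mathbf e\in\mathbb W_\theta^n$ and $\mathbf e\in\{0,1\}^n$. The number $Z(\mathbf x)$ is the normalization constant for which $\sum_{\mathbf e\in\{0,1\}^n}\mathbb P(\mathbf x+\mathbf e\mid\mathbf x)=1$; it is assumed that such a constant exists. The expectation $\mathbb E$ is with respect to the random $\mathbf e$, with $\mathbf x$ and $z$ fixed.
   Formalization: Since b(z+θ) is evaluated for z in U but may be undefined when b is given only on U, b is assumed holomorphic on U ∪ (U+θ), and injective on U only. *)

theory Defs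
  imports "HOL-Complex_Analysis.Complex_Analysis" "HOL-Probability.Probability"
begin

text \<open>An \<open>n\<close>-tuple is a function on \<open>nat\<close> of which only the values at \<open>1, \<dots>, n\<close> matter.\<close>

definition W :: "real \<Rightarrow> nat \<Rightarrow> (nat \<Rightarrow> real) set" where
  "W \<theta> n = {x. x 1 \<in> \<int> \<and> (\<forall>i\<in>{1..<n}. \<exists>k::nat. x i - x (i + 1) = \<theta> + real k)}"

definition bits :: "nat \<Rightarrow> (nat \<Rightarrow> nat) set" where
  "bits n = {1..n} \<rightarrow>\<^sub>E {0, 1}"

text \<open>
  The constant \<open>Z\<close> is a parameter; it is pinned down by requiring that the values
  of \<open>trans_prob\<close> sum to \<open>1\<close> over \<open>bits n\<close> (which also forces \<open>Z \<noteq> 0\<close>).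
  As \<open>b\<close>, \<open>\<phi>p\<close>, \<open>\<phi>m\<close> are complex-valued, so are these weights; they need not be nonnegative.
\<close>

definition trans_prob ::
  "real \<Rightarrow> nat \<Rightarrow> (nat \<Rightarrow> real) \<Rightarrow> (complex \<Rightarrow> complex) \<Rightarrow> (complex \<Rightarrow> complex) \<Rightarrow> (complex \<Rightarrow> complex)
    \<Rightarrow> complex \<Rightarrow> (nat \<Rightarrow> nat) \<Rightarrow> complex" where
  "trans_prob \<theta> n x b \<phi>p \<phi>m Z e =
     1 / Z *
     (\<Prod>(i, j) \<in> {(i, j). 1 \<le> i \<and> i < j \<and> j \<le> n}.
        (b (of_real (x i + \<theta> * real (e i))) - b (of_real (x j + \<theta> * real (e j)))) /
        (b (of_real (x i)) - b (of_real (x j)))) *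
     (\<Prod>i = 1..n. \<phi>p (of_real (x i)) ^ e i * \<phi>m (of_real (x i)) ^ (1 - e i))"

definition expect :: "nat \<Rightarrow> ((nat \<Rightarrow> nat) \<Rightarrow> complex) \<Rightarrow> ((nat \<Rightarrow> nat) \<Rightarrow> complex) \<Rightarrow> complex" where
  "expect n P f = (\<Sum>e \<in> bits n. P e * f e)"

text \<open>If the weights do form a probability distribution, \<open>expect\<close> is its expectation.\<close>

lemma expect_eq_expectation_pmf:
  fixes p :: "(nat \<Rightarrow> nat) pmf"
  assumes "set_pmf p \<subseteq> bits n" and "\<And>e. e \<in> bits n \<Longrightarrow> of_real (pmf p e) = P e"
  shows "expect n P f = measure_pmf.expectation p f"
proof -
  have fin: "finite (bits n)"
    by (simp add: bits_def finite_PiE)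
  have "measure_pmf.expectation p f = (\<Sum>e\<in>bits n. pmf p e *\<^sub>R f e)"
    by (rule integral_measure_pmf) (use fin assms(1) in auto)
  also have "\<dots> = expect n P f"
    unfolding expect_def by (rule sum.cong) (auto simp: scaleR_conv_of_real assms(2))
  finally show ?thesis by simp
qed

text \<open>
  Jumps that leave the state space have weight zero, so it makes no difference whether sums
  run over all of \<open>bits n\<close> or only over those \<open>e\<close> with \<open>x + e\<close> in \<open>W \<theta> n\<close>.
\<close>

lemma trans_prob_eq_0:
  assumes x: "x \<in> W \<theta> n" and e: "e \<in> bits n" and n: "n \<ge> 1"
    and out: "(\<lambda>i. x i + real (e i)) \<notin> W \<theta> n"
  shows "trans_prob \<theta> n x b \<phi>p \<phi>m Z e = 0"
proof -
  have "x 1 + real (e 1) \<in> \<int>"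
    using x by (auto simp: W_def)
  with out obtain i where i: "i \<in> {1..<n}"
    and no: "\<And>k::nat. x i + real (e i) - (x (i + 1) + real (e (i + 1))) \<noteq> \<theta> + real k"
    by (auto simp: W_def)
  obtain k :: nat where k: "x i - x (i + 1) = \<theta> + real k"
    using x i unfolding W_def by blast
  have e01: "e i \<in> {0, 1}" "e (i + 1) \<in> {0, 1}"
    using e i by (auto simp: bits_def PiE_iff)
  have "k + e i < e (i + 1)"
  proof (rule ccontr)
    assume "\<not> ?thesis"
    then have "real (k + e i - e (i + 1)) = real k + real (e i) - real (e (i + 1))"
      by (simp add: of_nat_diff)
    with no[of "k + e i - e (i + 1)"] k show False by simp
  qed
  with e01 have "k = 0" "e i = 0" "e (i + 1) = 1" by auto
  with k have "x i + \<theta> * real (e i) = x (i + 1) + \<theta> * real (e (i + 1))" by simp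
  moreover have "finite {(i, j). 1 \<le> i \<and> i < j \<and> j \<le> n}"
    by (rule finite_subset[of _ "{1..n} \<times> {1..n}"]) auto
  moreover have "(i, i + 1) \<in> {(i, j). 1 \<le> i \<and> i < j \<and> j \<le> n}"
    using i by auto
  ultimately have "(\<Prod>(i, j) \<in> {(i, j). 1 \<le> i \<and> i < j \<and> j \<le> n}.
        (b (of_real (x i + \<theta> * real (e i))) - b (of_real (x j + \<theta> * real (e j)))) /
        (b (of_real (x i)) - b (of_real (x j)))) = 0"
    by (intro prod_zero bexI[of _ "(i, i + 1)"]) (simp_all only: prod.case diff_self div_0)
  then show ?thesis by (simp add: trans_prob_def)
qed

end

theory Submission
  imports Defs
begin

text \<open>
  Multiplied by \<open>\<Prod>\<^sub>j (b z - b (x\<^sub>j))\<close>, the observable becomes holomorphic on \<open>U\<close>. Since \<open>b\<close> is injective,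
  its singularities are at most simple poles at the points \<open>x\<^sub>m\<close>, so it suffices that the
  numerator vanishes there. At \<open>z = x\<^sub>m\<close> the \<open>\<phi>p\<close>-term survives only if \<open>e\<^sub>m = 0\<close> and the \<open>\<phi>m\<close>-term
  only if \<open>e\<^sub>m = 1\<close>; for two tuples differing only in \<open>e\<^sub>m\<close> the two surviving terms cancel.
\<close>

text \<open>As \<open>N a = 0\<close>, \<open>N z\<close> and \<open>b z - b a\<close> are
  \<open>z - a\<close> times the difference quotients of \<open>N\<close> and \<open>b\<close> at
  \<open>a\<close>. The quotient for \<open>b\<close> never vanishes because \<open>b\<close> is
  injective, so the ratio of the two can serve as \<open>F\<close>.\<close>

lemma holomorphic_divide_inj:
  fixes b N :: "complex \<Rightarrow> complex"
  assumes U: "open U" and N: "N holomorphic_on U" and b: "b holomorphic_on U" and inj: "inj_on b U"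
    and a: "a \<in> U" and Na: "N a = 0"
  obtains F where "F holomorphic_on U" and "\<And>z. z \<in> U \<Longrightarrow> N z = F z * (b z - b a)"
proof -
  \<comment> \<open>The difference quotient at \<open>a\<close>, with its removable singularity
    filled by the derivative.\<close>
  define Q where "Q = (\<lambda>f z. if z = a then deriv f a else (f z - f a) / (z - a) :: complex)"
  have Q: "Q f holomorphic_on U" if "f holomorphic_on U" for f
    unfolding Q_def by (rule pole_lemma_open[OF that U])
  have Q_eq: "f z - f a = (z - a) * Q f z" for f z
    by (simp add: Q_def)
  have nz: "Q b z \<noteq> 0" if z: "z \<in> U" for z
  proof (cases "z = a")
    case True
    then show ?thesis
      \<comment> \<open>An injective holomorphic function has nonvanishing derivative.\<close>
      using holomorphic_injective_imp_regular[OF b U inj a] by (simp add: Q_def)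
  next
    case False
    then show ?thesis
      using inj_onD[OF inj _ z a] by (auto simp: Q_def)
  qed
  show thesis
  proof
    show "(\<lambda>z. Q N z / Q b z) holomorphic_on U"
      using nz by (intro holomorphic_on_divide Q N b) auto
    show "N z = Q N z / Q b z * (b z - b a)" if "z \<in> U" for z
      using Q_eq[of N z] Q_eq[of b z] nz[OF that] Na by simp
  qed
qed

text \<open>Divide out one zero at a time, which works because the cofactor keeps the zeros still to
  be treated.\<close>

lemma holomorphic_divide_prod_inj:
  fixes b N :: "complex \<Rightarrow> complex"
  assumes "finite S" and U: "open U" and b: "b holomorphic_on U" and inj: "inj_on b U"
    and "S \<subseteq> U" and "N holomorphic_on U" and "\<And>s. s \<in> S \<Longrightarrow> N s = 0"
  shows "\<exists>F. F holomorphic_on U \<and> (\<forall>z\<in>U. N z = F z * (\<Prod>s\<in>S. b z - b s))"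
  using assms(1,5-)
proof (induction S arbitrary: N rule: finite_induct)
  case empty
  then show ?case by auto
next
  case (insert a S)
  obtain N1 where N1: "N1 holomorphic_on U" "\<And>z. z \<in> U \<Longrightarrow> N z = N1 z * (b z - b a)"
    by (rule holomorphic_divide_inj[OF U insert.prems(2) b inj, of a]) (use insert.prems in auto)
  \<comment> \<open>Since \<open>s\<close> differs from \<open>a\<close>, injectivity makes
    \<open>b s - b a\<close> nonzero, so the zero of \<open>N\<close> at \<open>s\<close> must come
    from \<open>N1\<close>.\<close>
  have "N1 s = 0" if "s \<in> S" for s
  proof -
    have "s \<in> U" "a \<in> U" "s \<noteq> a" "N s = 0"
      using that insert by auto
    then show ?thesis
      using N1(2)[of s] inj_onD[OF inj, of s a] by auto
  qed
  with insert.IH[OF _ N1(1)] insert.prems obtain F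
    where "F holomorphic_on U" "\<And>z. z \<in> U \<Longrightarrow> N1 z = F z * (\<Prod>s\<in>S. b z - b s)"
    by auto
  with N1 insert.hyps show ?case
    by (intro exI[of _ F]) (simp add: mult_ac)
qed

text \<open>Isolates the interactions of particle \<open>m\<close> with all others. Symmetry of
  \<open>f\<close> allows \<open>m\<close> to be written first, whichever index is smaller.\<close>

lemma prod_ordered_pairs_split:
  fixes f :: "nat \<Rightarrow> nat \<Rightarrow> 'a::comm_monoid_mult"
  assumes sym: "\<And>i j. f i j = f j i" and m: "m \<in> {1..n}"
  shows "(\<Prod>(i, j)\<in>{(i, j). 1 \<le> i \<and> i < j \<and> j \<le> n}. f i j) =
    (\<Prod>(i, j)\<in>{(i, j). 1 \<le> i \<and> i < j \<and> j \<le> n \<and> i \<noteq> m \<and> j \<noteq> m}. f i j) *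
    (\<Prod>j\<in>{1..n} - {m}. f m j)"
proof -
  let ?A = "{(i, j). 1 \<le> i \<and> i < j \<and> j \<le> n \<and> i \<noteq> m \<and> j \<noteq> m}"
  \<comment> \<open>The increasing representative of the unordered pair of \<open>m\<close> and
    \<open>j\<close>.\<close>
  let ?g = "\<lambda>j. (min m j, max m j)"
  let ?B = "?g ` ({1..n} - {m})"
  have "{(i, j). 1 \<le> i \<and> i < j \<and> j \<le> n} = ?A \<union> ?B" (is "?P = _")
  proof (intro equalityI subsetI)
    fix p assume "p \<in> ?P"
    then obtain i j where p: "p = (i, j)" "1 \<le> i" "i < j" "j \<le> n" by auto
    show "p \<in> ?A \<union> ?B"
    proof (cases "i = m \<or> j = m")
      case True
      then have "p = ?g (if i = m then j else i)" using p by auto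
      moreover have "(if i = m then j else i) \<in> {1..n} - {m}" using p True by auto
      ultimately show ?thesis by blast
    qed (use p in auto)
  next
    fix p assume "p \<in> ?A \<union> ?B"
    then show "p \<in> ?P" using m by (auto simp: min_def max_def)
  qed
  moreover have "finite ?A"
    by (rule finite_subset[of _ "{1..n} \<times> {1..n}"]) auto
  moreover have "?A \<inter> ?B = {}"
    by (auto simp: min_def max_def split: if_splits)
  moreover have "inj_on ?g ({1..n} - {m})"
    by (auto simp: inj_on_def min_def max_def split: if_splits)
  moreover have "f (min m j) (max m j) = f m j" for j
    using sym by (auto simp: min_def max_def)
  ultimately show ?thesis
    by (simp add: prod.union_disjoint prod.reindex)
qed

text \<open>Flipping the bit at \<open>m\<close> pairs the tuples with \<open>e m = 0\<close> with
  those with \<open>e m = 1\<close>, and each pair contributes zero.\<close>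

lemma sum_bits_eq_0:
  fixes g :: "(nat \<Rightarrow> nat) \<Rightarrow> 'a::comm_monoid_add"
  assumes m: "m \<in> {1..n}"
    and cancel: "\<And>e. e \<in> bits n \<Longrightarrow> e m = 0 \<Longrightarrow> g e + g (e(m := 1)) = 0"
  shows "(\<Sum>e\<in>bits n. g e) = 0"
proof -
  let ?B = "\<lambda>k. {e \<in> bits n. e m = k}"
  have fin: "finite (bits n)"
    by (simp add: bits_def finite_PiE)
  have upd: "e(m := k) \<in> bits n" if "e \<in> bits n" "k \<in> {0, 1}" for e k
    using PiE_fun_upd[of k "\<lambda>_. {0, 1}" m e "{1..n}"] that m by (simp add: bits_def insert_absorb)
  have "e m \<in> {0, 1}" if "e \<in> bits n" for e
    using PiE_mem[OF that[unfolded bits_def] m] .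
  then have split: "bits n = ?B 0 \<union> ?B 1"
    by blast
  have "(\<Sum>e\<in>bits n. g e) = (\<Sum>e\<in>?B 0. g e) + (\<Sum>e\<in>?B 1. g e)"
    by (subst split, rule sum.union_disjoint) (use fin in auto)
  also have "(\<Sum>e\<in>?B 1. g e) = (\<Sum>e\<in>?B 0. g (e(m := 1)))"
    by (rule sum.reindex_bij_witness[of _ "\<lambda>e. e(m := 1)" "\<lambda>e. e(m := 0)"])
      (auto simp: upd fun_upd_idem)
  also have "(\<Sum>e\<in>?B 0. g e) + (\<Sum>e\<in>?B 0. g (e(m := 1))) = 0"
    using cancel by (simp flip: sum.distrib)
  finally show ?thesis .
qed

text \<open>Makes the dependence of the weight on the bit at \<open>m\<close> explicit: one factor
  \<open>K e\<close> serves both values of \<open>k\<close>, so the weights of two tuples differing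
  only at \<open>m\<close> can be compared.\<close>

lemma trans_prob_split:
  assumes m: "m \<in> {1..n}"
  obtains K where "\<And>e k. k \<in> {0, 1} \<Longrightarrow> trans_prob \<theta> n x b \<phi>p \<phi>m Z (e(m := k)) =
    K e * \<phi>p (of_real (x m)) ^ k * \<phi>m (of_real (x m)) ^ (1 - k) *
    (\<Prod>j\<in>{1..n} - {m}. b (of_real (x m + \<theta> * real k)) - b (of_real (x j + \<theta> * real (e j))))"
proof -
  define f where "f = (\<lambda>e i j.
    (b (of_real (x i + \<theta> * real (e i))) - b (of_real (x j + \<theta> * real (e j)))) /
    (b (of_real (x i)) - b (of_real (x j))))"
  define h where "h = (\<lambda>(e :: nat \<Rightarrow> nat) i.
    \<phi>p (of_real (x i)) ^ e i * \<phi>m (of_real (x i)) ^ (1 - e i))"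
  define A where "A = {(i, j). 1 \<le> i \<and> i < j \<and> j \<le> n \<and> i \<noteq> m \<and> j \<noteq> m}"
  \<comment> \<open>Collects all factors that do not involve \<open>e m\<close>, including the
    denominators of the interactions with \<open>m\<close>. Splitting off these denominators is
    valid even if some vanish, since division by zero yields zero.\<close>
  define K where "K = (\<lambda>e. 1 / Z * (\<Prod>(i, j)\<in>A. f e i j) * (\<Prod>i\<in>{1..n} - {m}. h e i) /
    (\<Prod>j\<in>{1..n} - {m}. b (of_real (x m)) - b (of_real (x j))))"
  \<comment> \<open>Swapping \<open>i\<close> and \<open>j\<close> changes the sign of both
    numerator and denominator.\<close>
  have sym: "f e i j = f e j i" for e i j
    unfolding f_def by (metis minus_diff_eq minus_divide_divide)
  have tp: "trans_prob \<theta> n x b \<phi>p \<phi>m Z e = 1 / Z * ((\<Prod>(i, j)\<in>A. f e i j) *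
      (\<Prod>j\<in>{1..n} - {m}. f e m j)) * (h e m * (\<Prod>i\<in>{1..n} - {m}. h e i))" for e
    unfolding trans_prob_def A_def
    using prod_ordered_pairs_split[of "f e", OF sym m] prod.remove[OF _ m, of "h e"]
    by (simp add: f_def h_def)
  have "trans_prob \<theta> n x b \<phi>p \<phi>m Z (e(m := k)) =
    K e * \<phi>p (of_real (x m)) ^ k * \<phi>m (of_real (x m)) ^ (1 - k) *
    (\<Prod>j\<in>{1..n} - {m}. b (of_real (x m + \<theta> * real k)) - b (of_real (x j + \<theta> * real (e j))))" for e k
  proof -
    have "(\<Prod>(i, j)\<in>A. f (e(m := k)) i j) = (\<Prod>(i, j)\<in>A. f e i j)"
      by (rule prod.cong) (auto simp: A_def f_def)
    moreover have "(\<Prod>i\<in>{1..n} - {m}. h (e(m := k)) i) = (\<Prod>i\<in>{1..n} - {m}. h e i)"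
      by (rule prod.cong) (auto simp: h_def)
    moreover have "(\<Prod>j\<in>{1..n} - {m}. f (e(m := k)) m j) =
      (\<Prod>j\<in>{1..n} - {m}. b (of_real (x m + \<theta> * real k)) - b (of_real (x j + \<theta> * real (e j)))) /
      (\<Prod>j\<in>{1..n} - {m}. b (of_real (x m)) - b (of_real (x j)))"
      unfolding prod_dividef[symmetric] by (rule prod.cong) (auto simp: f_def)
    ultimately show ?thesis
      unfolding tp by (simp add: K_def h_def mult_ac)
  qed
  then show thesis by (intro that)
qed

lemma numerator_eq_0:
  fixes x :: "nat \<Rightarrow> real"
  assumes m: "m \<in> {1..n}"
  shows "expect n (trans_prob \<theta> n x b \<phi>p \<phi>m Z) (\<lambda>e.
      \<phi>p (of_real (x m)) * (\<Prod>j = 1..n. b (of_real (x m) + of_real \<theta>) - b (of_real (x j + \<theta> * real (e j)))) +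
      \<phi>m (of_real (x m)) * (\<Prod>j = 1..n. b (of_real (x m)) - b (of_real (x j + \<theta> * real (e j))))) = 0"
  unfolding expect_def
proof (rule sum_bits_eq_0[OF m])
  fix e :: "nat \<Rightarrow> nat" assume "e \<in> bits n" and em: "e m = 0"
  obtain K where K: "\<And>e k. k \<in> {0, 1} \<Longrightarrow> trans_prob \<theta> n x b \<phi>p \<phi>m Z (e(m := k)) =
    K e * \<phi>p (of_real (x m)) ^ k * \<phi>m (of_real (x m)) ^ (1 - k) *
    (\<Prod>j\<in>{1..n} - {m}. b (of_real (x m + \<theta> * real k)) - b (of_real (x j + \<theta> * real (e j))))"
    using trans_prob_split[OF m] by blast
  \<comment> \<open>The contribution of the other particles, as a polynomial in \<open>w\<close>.
    The weights and the products in the observable both involve only its values at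
    \<open>b (x m)\<close> and \<open>b (x m + \<theta>)\<close>.\<close>
  define p where "p = (\<lambda>w. \<Prod>j\<in>{1..n} - {m}. w - b (of_real (x j + \<theta> * real (e j))))"
  have prod: "(\<Prod>j = 1..n. w - b (of_real (x j + \<theta> * real ((e(m := k)) j)))) =
      (w - b (of_real (x m + \<theta> * real k))) * p w" for w k
  proof -
    have "(\<Prod>j\<in>{1..n} - {m}. w - b (of_real (x j + \<theta> * real ((e(m := k)) j)))) = p w"
      unfolding p_def by (rule prod.cong) auto
    then show ?thesis
      by (subst prod.remove[OF _ m]) auto
  qed
  have e0: "e = e(m := 0)" using em by auto
  have tp0: "trans_prob \<theta> n x b \<phi>p \<phi>m Z e = K e * \<phi>m (of_real (x m)) * p (b (of_real (x m)))"
    using K[of 0 e, folded e0] by (simp add: p_def)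
  have tp1: "trans_prob \<theta> n x b \<phi>p \<phi>m Z (e(m := 1)) =
      K e * \<phi>p (of_real (x m)) * p (b (of_real (x m) + of_real \<theta>))"
    using K[of 1 e] by (simp add: p_def)
  show "trans_prob \<theta> n x b \<phi>p \<phi>m Z e * (
      \<phi>p (of_real (x m)) * (\<Prod>j = 1..n. b (of_real (x m) + of_real \<theta>) - b (of_real (x j + \<theta> * real (e j)))) +
      \<phi>m (of_real (x m)) * (\<Prod>j = 1..n. b (of_real (x m)) - b (of_real (x j + \<theta> * real (e j))))) +
    trans_prob \<theta> n x b \<phi>p \<phi>m Z (e(m := 1)) * (
      \<phi>p (of_real (x m)) * (\<Prod>j = 1..n. b (of_real (x m) + of_real \<theta>) - b (of_real (x j + \<theta> * real ((e(m := 1)) j)))) +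
      \<phi>m (of_real (x m)) * (\<Prod>j = 1..n. b (of_real (x m)) - b (of_real (x j + \<theta> * real ((e(m := 1)) j))))) = 0"
    \<comment> \<open>Put \<open>u = b (x m)\<close> and \<open>v = b (x m + \<theta>)\<close>. The
      surviving terms are \<open>K e\<close>, \<open>\<phi>p\<close>, \<open>\<phi>m\<close>,
      \<open>p u\<close> and \<open>p v\<close> multiplied together, times \<open>v - u\<close> for
      bit 0 and \<open>u - v\<close> for bit 1.\<close>
    unfolding prod prod[of _ 0, folded e0] tp0 tp1 by (simp add: algebra_simps)
qed

lemma W_less:
  assumes x: "x \<in> W \<theta> n" and \<theta>: "\<theta> > 0" and ij: "1 \<le> i" "i < j" "j \<le> n"
  shows "x j < x i"
proof -
  have less: "x (k + 1) < x k" if "1 \<le> k" "k < n" for k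
  proof -
    have "\<forall>i\<in>{1..<n}. \<exists>l::nat. x i - x (i + 1) = \<theta> + real l"
      using x by (simp add: W_def)
    from bspec[OF this, of k] that obtain l :: nat where "x k - x (k + 1) = \<theta> + real l"
      by auto
    with \<theta> show ?thesis by simp
  qed
  have "Suc i \<le> j" using ij by simp
  then show ?thesis using ij(3)
  proof (induction j rule: dec_induct)
    case base
    then show ?case using less[of i] ij(1) by simp
  next
    case (step k)
    then have "x (k + 1) < x k" "x k < x i"
      using less[of k] by simp_all
    then show ?case by simp
  qed
qed

text \<open>The observable is a quotient by zero at the points \<open>x j\<close>, so holomorphy on
  \<open>U\<close> means that a holomorphic \<open>F\<close> agrees with it elsewhere. As it
  evaluates \<open>b\<close> at \<open>z + \<theta>\<close>, \<open>b\<close> is taken holomorphic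
  on the translate of \<open>U\<close> too.\<close>

theorem theorem1p1:
  fixes U :: "complex set" and \<theta> :: real and n :: nat and x :: "nat \<Rightarrow> real"
    and \<phi>p \<phi>m b :: "complex \<Rightarrow> complex" and Z :: complex
  assumes "open U" and "\<theta> > 0" and "n \<ge> 1"
    and "x \<in> W \<theta> n" and "complex_of_real ` {x n..x 1} \<subseteq> U"
    and "\<phi>p holomorphic_on U" and "\<phi>m holomorphic_on U"
    and "b holomorphic_on U \<union> (\<lambda>z. z + of_real \<theta>) ` U" and "inj_on b U"
    and "(\<Sum>e \<in> bits n. trans_prob \<theta> n x b \<phi>p \<phi>m Z e) = 1"
  shows "\<exists>F. F holomorphic_on U \<and>
    (\<forall>z \<in> U - (\<lambda>j. of_real (x j)) ` {1..n}.
      F z = expect n (trans_prob \<theta> n x b \<phi>p \<phi>m Z) (\<lambda>e.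
        \<phi>p z * (\<Prod>j = 1..n. (b (z + of_real \<theta>) - b (of_real (x j + \<theta> * real (e j)))) /
                           (b z - b (of_real (x j)))) +
        \<phi>m z * (\<Prod>j = 1..n. (b z - b (of_real (x j + \<theta> * real (e j)))) /
                           (b z - b (of_real (x j))))))"
proof -
  let ?P = "trans_prob \<theta> n x b \<phi>p \<phi>m Z"
  let ?y = "\<lambda>j. complex_of_real (x j)"
  let ?c = "\<lambda>e j. b (of_real (x j + \<theta> * real (e j)))"
  define N where "N = (\<lambda>z. expect n ?P (\<lambda>e.
    \<phi>p z * (\<Prod>j = 1..n. b (z + of_real \<theta>) - ?c e j) + \<phi>m z * (\<Prod>j = 1..n. b z - ?c e j)))"
  note less = W_less[OF \<open>x \<in> W \<theta> n\<close> \<open>\<theta> > 0\<close>]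
  \<comment> \<open>Distinctness of the particles makes every pole simple and lets the product over
    the set of positions be rewritten as a product over indices.\<close>
  have inj: "inj_on ?y {1..n}"
    by (rule linorder_inj_onI) (use less in force)+
  have "x n \<le> x j \<and> x j \<le> x 1" if "j \<in> {1..n}" for j
    using less[of 1 j] less[of j n] that by (cases "j = 1"; cases "j = n") auto
  then have sub: "?y ` {1..n} \<subseteq> U"
    using assms(5) by auto
  have b: "b holomorphic_on U"
    by (rule holomorphic_on_subset[OF assms(8)]) auto
  have "(b \<circ> (\<lambda>z. z + of_real \<theta>)) holomorphic_on U"
    by (intro holomorphic_on_compose holomorphic_intros holomorphic_on_subset[OF assms(8)]) auto
  then have b\<theta>: "(\<lambda>z. b (z + of_real \<theta>)) holomorphic_on U"
    by (simp add: o_def)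
  have "N holomorphic_on U"
    unfolding N_def expect_def using assms(6,7) b b\<theta> by (intro holomorphic_intros)
  moreover have "N s = 0" if "s \<in> ?y ` {1..n}" for s
    using that numerator_eq_0 by (auto simp: N_def)
  ultimately have "\<exists>F. F holomorphic_on U \<and> (\<forall>z\<in>U. N z = F z * (\<Prod>s\<in>?y ` {1..n}. b z - b s))"
    by (intro holomorphic_divide_prod_inj \<open>open U\<close> b \<open>inj_on b U\<close> sub finite_imageI finite_atLeastAtMost)
  then obtain F where F: "F holomorphic_on U"
    and NF: "\<And>z. z \<in> U \<Longrightarrow> N z = F z * (\<Prod>s\<in>?y ` {1..n}. b z - b s)"
    by blast
  have "F z = expect n ?P (\<lambda>e.
        \<phi>p z * (\<Prod>j = 1..n. (b (z + of_real \<theta>) - ?c e j) / (b z - b (?y j))) +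
        \<phi>m z * (\<Prod>j = 1..n. (b z - ?c e j) / (b z - b (?y j))))"
    if z: "z \<in> U - ?y ` {1..n}" for z
  proof -
    define D where "D = (\<Prod>j = 1..n. b z - b (?y j))"
    have "b z \<noteq> b (?y j)" if "j \<in> {1..n}" for j
      using inj_onD[OF \<open>inj_on b U\<close>, of z "?y j"] z sub that by blast
    then have "D \<noteq> 0"
      by (auto simp: D_def)
    moreover have "N z = F z * D"
      using NF[of z] z inj by (simp add: prod.reindex D_def)
    ultimately have "F z = N z / D" by simp
    \<comment> \<open>The denominator \<open>D\<close> does not depend on \<open>e\<close>, so it
      can be moved inside the expectation.\<close>
    also have "\<dots> = expect n ?P (\<lambda>e. \<phi>p z * ((\<Prod>j = 1..n. b (z + of_real \<theta>) - ?c e j) / D) +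
        \<phi>m z * ((\<Prod>j = 1..n. b z - ?c e j) / D))"
      unfolding N_def expect_def sum_divide_distrib
      by (rule sum.cong) (simp_all flip: add_divide_distrib)
    finally show ?thesis
      by (simp only: D_def prod_dividef)
  qed
  with F show ?thesis by blast
qed

end
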